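(* Let $E=\mathbb{R}$, let $\mathcal{M}_\Theta:=\{{\rm G}_a:a\in(0,\infty)\}$ be the class of all Gumbel distributions with location parameter $0$, let $\mathcal{M}:=\mathcal{M}_1^{(\psi_k)}\setminus\{\delta_0\}$ with $\psi_k(x):=|\log a_k-a_kx-e^{-a_kx}|$, where $(a_k)$ is a sequence enumerating $(0,\infty)\cap\mathbb{Q}$, and let $T:\mathcal{M}\to(0,\infty)$ be the unique maximum likelihood functional. Then the sequence of maximum likelihood estimators $(\widehat T_n)$, given by $\widehat T_n(\boldsymbol{x}):=T(\frac1n\sum_{i=1}^n\delta_{x_i})$ for $\boldsymbol{x}=(x_1,x_2,\ldots)\in\mathbb{R}^{\mathbb{N}}$, is robust on $\mathcal{M}_\Theta$.
   Context: ${\rm G}_a$, $a>0$, is the Borel probability measure on $\mathbb{R}$ with Lebesgue density $f_a(x)=ae^{-ax-e^{-ax}}$. $\mathcal{M}_1^{(\psi_k)}$ is the set of all Borel probability measures $\mu$ on $\mathbb{R}$ with $\int\psi_k\,d\mu<\infty$ for every $k\in\mathbb{N}$, and $\delta_0$ is the Dirac measure at $0$. The maximum likelihood functional $T:\mathcal{M}\to(0,\infty)$ assigns to $\mu\in\mathcal{M}$ the unique maximizer over $a\in(0,\infty)$ of $\int\log f_a\,d\mu=\int(\log a-ax-e^{-ax})\,\mu(dx)$. Robustness: for a Borel probability measure $\mu$ on $\mathbb{R}$ let $\mathbb{P}^\mu:=\mu^{\otimes\mathbb{N}}$ on $\mathbb{R}^{\mathbb{N}}$. The state space $\Sigma=(0,\infty)$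 is equipped with a complete metric inducing its usual topology, and $\pi$ is the corresponding Prohorov metric on the Borel probability measures on $\Sigma$. The sequence $(\widehat T_n)$ is robust on a set $M$ of Borel probability measures on $\mathbb{R}$ if for every $\mu\in M$ and $\varepsilon>0$ there is an open neighborhood $U$ of $\mu$ for the relative weak topology on $M$ such that $\pi(\mathbb{P}^\mu\circ\widehat T_n^{-1},\mathbb{P}^\nu\circ\widehat T_n^{-1})\le\varepsilon$ for all $\nu\in U$ and all $n\in\mathbb{N}$. *)

theory Defs
  imports "HOL-Probability.Probability"
begin

section \<open>Weak topology and Prohorov metric\<close>

definition borel_probs :: "'a::topological_space measure set" where
  "borel_probs = {\<mu>. prob_space \<mu> \<and> sets \<mu> = sets borel}"

text \<open>The coarsest topology on the Borel probability measures for which \<open>\<mu> \<mapsto> \<integral>f d\<mu>\<close> is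
  continuous for every bounded continuous \<open>f\<close>.\<close>

definition weak_topology :: "'a::topological_space measure topology" where
  "weak_topology = topology_generated_by
     {{\<mu> \<in> borel_probs. (\<integral>x. f x \<partial>\<mu>) \<in> V} | (f :: 'a \<Rightarrow> real) V.
        continuous_on UNIV f \<and> bounded (range f) \<and> open V}"

text \<open>Here and in \<open>estimator_law\<close> below, the metric of \<open>m\<close> is meant to induce the
  subspace topology of its carrier, so that \<open>restrict_space borel (mspace m)\<close> carries the Borel sets of the metric
  space.\<close>

definition prohorov_dist :: "'b::topological_space metric \<Rightarrow> 'b measure \<Rightarrow> 'b measure \<Rightarrow> real" where
  "prohorov_dist m P Q = Inf {e. 0 < e \<and>
     (\<forall>A \<in> sets (restrict_space borel (mspace m)).
        measure P A \<le> measure Q {y \<in> mspace m. \<exists>x\<in>A. mdist m x y < e} + e \<and>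
        measure Q A \<le> measure P {y \<in> mspace m. \<exists>x\<in>A. mdist m x y < e} + e)}"

section \<open>Robustness\<close>

text \<open>Samples \<open>(x\<^sub>1, x\<^sub>2, \<dots>)\<close> are indexed from 0, so the first \<open>n\<close> observations
  are \<open>x 0, \<dots>, x (n - 1)\<close>.\<close>

definition estimator_law ::
    "'b::topological_space metric \<Rightarrow> ((nat \<Rightarrow> 'a) \<Rightarrow> 'b) \<Rightarrow> 'a measure \<Rightarrow> 'b measure" where
  "estimator_law m t \<mu> =
     distr (Pi\<^sub>M (UNIV :: nat set) (\<lambda>_. \<mu>)) (restrict_space borel (mspace m)) t"

definition robust_on ::
    "'b::topological_space metric \<Rightarrow> (nat \<Rightarrow> (nat \<Rightarrow> 'a::topological_space) \<Rightarrow> 'b)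
       \<Rightarrow> 'a measure set \<Rightarrow> bool" where
  "robust_on m T M \<longleftrightarrow>
     (\<forall>\<mu>\<in>M. \<forall>\<epsilon>>0. \<exists>U. openin (subtopology weak_topology M) U \<and> \<mu> \<in> U \<and>
        (\<forall>\<nu>\<in>U. \<forall>n\<ge>1.
           prohorov_dist m (estimator_law m (T n) \<mu>) (estimator_law m (T n) \<nu>) \<le> \<epsilon>))"

definition empirical_measure :: "nat \<Rightarrow> (nat \<Rightarrow> 'a::topological_space) \<Rightarrow> 'a measure" where
  "empirical_measure n x =
     measure_of UNIV (sets borel) (\<lambda>A. (\<Sum>i<n. emeasure (return borel (x i)) A) / of_nat n)"

section \<open>Maximum likelihood in the Gumbel model\<close>

definition gumbel_density :: "real \<Rightarrow> real \<Rightarrow> real" where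
  "gumbel_density a x = a * exp (- (a * x) - exp (- (a * x)))"

definition gumbel :: "real \<Rightarrow> real measure" where
  "gumbel a = density lborel (\<lambda>x. ennreal (gumbel_density a x))"

definition psi :: "(nat \<Rightarrow> real) \<Rightarrow> nat \<Rightarrow> real \<Rightarrow> real" where
  "psi a k x = \<bar>ln (a k) - a k * x - exp (- (a k * x))\<bar>"

definition integrable_probs :: "(nat \<Rightarrow> 'a::topological_space \<Rightarrow> real) \<Rightarrow> 'a measure set" where
  "integrable_probs \<psi> = {\<mu> \<in> borel_probs. \<forall>k. (\<integral>\<^sup>+x. ennreal (\<psi> k x) \<partial>\<mu>) < \<infinity>}"

definition log_likelihood :: "real measure \<Rightarrow> real \<Rightarrow> real" where
  "log_likelihood \<mu> a = (\<integral>x. ln (gumbel_density a x) \<partial>\<mu>)"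

text \<open>Meaningful on \<open>integrable_probs (psi a) - {return borel 0}\<close> with \<open>a\<close> enumerating the
  positive rationals: there every \<open>ln (gumbel_density b x)\<close> is integrable and the maximizer is
  unique. For \<open>return borel 0\<close> the log-likelihood is \<open>ln a - 1\<close>, which has no maximizer.\<close>

definition gumbel_mle :: "real measure \<Rightarrow> real" where
  "gumbel_mle \<mu> = (THE a. 0 < a \<and> (\<forall>b>0. log_likelihood \<mu> b \<le> log_likelihood \<mu> a))"

end

theory Submission
  imports Defs
begin

text \<open>For a sample that is not identically zero the estimate is the unique \<open>b > 0\<close> at which the mean
  of \<open>score (b x\<^sub>i)\<close>, \<open>score t = t (1 - e\<^sup>-\<^sup>t)\<close>, equals 1; hence it is scale equivariant. Since
  \<open>gumbel a\<close> is the law of \<open>X / a\<close> for \<open>X\<close> distributed as \<open>gumbel 1\<close>, the laws of the estimator under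
  \<open>gumbel a\<close> and \<open>gumbel b\<close> are those of \<open>a S\<close> and \<open>b S\<close> for one and the same random variable \<open>S\<close>.
  The inequality \<open>score (c t) \<le> c score t\<close> for \<open>0 \<le> c \<le> 1\<close> and Markov's inequality confine \<open>S\<close>, up to a small
  probability, to a compact interval independent of the sample size, on which the metric is
  uniformly continuous. A weak neighbourhood of \<open>gumbel a\<close> controls the parameter because the
  integral of \<open>x\<^sup>2 / (1 + x\<^sup>2)\<close> is strictly decreasing in it.\<close>

section \<open>Maximum likelihood for empirical measures\<close>

text \<open>The derivative of \<open>ln b - b * x - exp (- (b * x))\<close> in \<open>b\<close> is
  \<open>(1 - score (b * x)) / b\<close>, so the likelihood equation of a sample asks for mean score
  1.\<close>

definition score :: "real \<Rightarrow> real" where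
  "score t = t * (1 - exp (- t))"

definition mean_score :: "nat \<Rightarrow> (nat \<Rightarrow> real) \<Rightarrow> real \<Rightarrow> real" where
  "mean_score n x b = (\<Sum>i<n. score (b * x i)) / real n"

lemma score_nonneg: "0 \<le> score t"
  unfolding score_def by (cases "0 \<le> t") (auto simp: mult_nonpos_nonpos)

lemma score_eq_0_iff [simp]: "score t = 0 \<longleftrightarrow> t = 0"
  unfolding score_def by auto

lemma borel_measurable_score [measurable]: "score \<in> borel_measurable borel"
  unfolding score_def by measurable

text \<open>The factor \<open>1 - exp (- (c * t))\<close> lies between 0 and
  \<open>1 - exp (- t)\<close>, whatever the sign of \<open>t\<close>. As \<open>score\<close> is
  not convex beyond 2, this replaces convexity: it makes \<open>mean_score n x b / b\<close>
  nondecreasing in \<open>b > 0\<close>.\<close>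

lemma score_scale_le:
  assumes "0 \<le> c" "c \<le> 1"
  shows "score (c * t) \<le> c * score t"
proof -
  have "t * (1 - exp (- (c * t))) \<le> t * (1 - exp (- t))"
  proof (cases "0 \<le> t")
    case True
    then have "c * t \<le> 1 * t" using assms by (intro mult_right_mono)
    with True show ?thesis by (intro mult_left_mono) auto
  next
    case False
    then have "1 * t \<le> c * t" using assms by (intro mult_right_mono_neg) auto
    with False show ?thesis by (intro mult_left_mono_neg) auto
  qed
  from mult_left_mono[OF this assms(1)] show ?thesis
    by (simp add: score_def mult_ac)
qed

lemma mean_score_nonneg: "0 \<le> mean_score n x b"
  by (simp add: mean_score_def sum_nonneg score_nonneg)

lemma mean_score_scale_le:
  assumes "0 < b" "b \<le> d"
  shows "mean_score n x b \<le> b / d * mean_score n x d"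
proof -
  have "(\<Sum>i<n. score (b * x i)) \<le> (\<Sum>i<n. b / d * score (d * x i))"
  proof (rule sum_mono)
    fix i
    show "score (b * x i) \<le> b / d * score (d * x i)"
      using score_scale_le[of "b / d" "d * x i"] assms by simp
  qed
  from divide_right_mono[OF this, of "real n"] show ?thesis
    by (simp add: mean_score_def sum_distrib_left[symmetric] sum_divide_distrib[symmetric] field_simps)
qed

lemma mean_score_eq_1_ex:
  assumes "j < n" "x j \<noteq> 0"
  shows "\<exists>b>0. mean_score n x b = 1"
proof -
  have n: "0 < real n" using assms by simp
  have q: "0 < score (x j)"
    using score_nonneg[of "x j"] score_eq_0_iff[of "x j"] assms(2) by linarith
  \<comment> \<open>At scale \<open>B\<close> the single nonzero observation already contributes at
    least \<open>n\<close> to the sum; \<open>1 \<le> B\<close> permits scaling by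
    \<open>1 / B\<close>.\<close>
  define B where "B = max 1 (real n / score (x j))"
  have "real n / score (x j) \<le> B" and B1: "1 \<le> B"
    by (simp_all add: B_def)
  then have B: "1 \<le> B" "real n \<le> B * score (x j)"
    using q by (simp_all add: pos_divide_le_eq)
  have "B * score (x j) \<le> score (B * x j)"
    using score_scale_le[of "1 / B" "B * x j"] B(1) by (simp add: field_simps)
  also have "\<dots> \<le> (\<Sum>i<n. score (B * x i))"
    using assms(1) by (intro member_le_sum) (auto simp: score_nonneg)
  finally have "1 \<le> mean_score n x B"
    using B(2) n by (simp add: mean_score_def)
  moreover have "mean_score n x 0 \<le> 1"
    by (simp add: mean_score_def score_def)
  moreover have "continuous_on {0..B} (mean_score n x)"
    unfolding mean_score_def score_def using n by (intro continuous_intros) auto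
  ultimately obtain b where b: "0 \<le> b" "b \<le> B" "mean_score n x b = 1"
    using IVT'[of "mean_score n x" 0 1 B] B(1) by auto
  then have "b \<noteq> 0" by (auto simp: mean_score_def score_def)
  with b show ?thesis by (intro exI[of _ b]) auto
qed

text \<open>By the scaling inequality the mean score crosses the level 1 only once. Comparing the
  estimate with a constant thus becomes an explicit condition on the data, from which measurability
  follows.\<close>

lemma mean_score_less_1_iff:
  assumes "0 < b" "mean_score n x b = 1" "0 < c"
  shows "mean_score n x c < 1 \<longleftrightarrow> c < b"
proof
  assume "c < b"
  with mean_score_scale_le[of c b n x] assms show "mean_score n x c < 1"
    by (simp add: order_le_less_trans)
next
  assume *: "mean_score n x c < 1"
  show "c < b"
  proof (rule ccontr)
    assume "\<not> c < b"
    then have "1 \<le> b / c * mean_score n x c"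
      using mean_score_scale_le[of b c n x] assms by simp
    also have "\<dots> \<le> 1 * mean_score n x c"
      using \<open>\<not> c < b\<close> assms by (intro mult_right_mono mean_score_nonneg) auto
    finally show False using * by simp
  qed
qed

section \<open>Empirical measures as laws of a uniformly chosen observation\<close>

lemma empirical_measure_eq_distr:
  fixes x :: "nat \<Rightarrow> 'a::topological_space"
  assumes "0 < n"
  shows "empirical_measure n x = distr (measure_pmf (pmf_of_set {..<n})) borel x"
    (is "_ = ?D")
proof -
  have "empirical_measure n x = measure_of UNIV (sets borel) (emeasure ?D)"
    unfolding empirical_measure_def
  proof (rule measure_of_eq)
    fix A :: "'a set" assume "A \<in> sigma_sets UNIV (sets borel)"
    then have A: "A \<in> sets borel"
      using sets.sigma_sets_eq[of "borel :: 'a measure"] by simp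
    have "emeasure ?D A = (\<integral>\<^sup>+i. indicator A (x i) \<partial>measure_pmf (pmf_of_set {..<n}))"
      using A nn_integral_distr[of x "measure_pmf (pmf_of_set {..<n})" borel "indicator A"]
      by simp
    also have "\<dots> = (\<Sum>i<n. indicator A (x i)) / of_nat n"
      using assms by (subst nn_integral_pmf_of_set) (auto simp: lessThan_empty_iff)
    finally show "(\<Sum>i<n. emeasure (return borel (x i)) A) / of_nat n = emeasure ?D A"
      using A by simp
  qed auto
  also have "\<dots> = ?D"
    using measure_of_of_measure[of ?D] by simp
  finally show ?thesis .
qed

lemma integral_empirical_measure:
  fixes f :: "'a::topological_space \<Rightarrow> real"
  assumes "0 < n" and [measurable]: "f \<in> borel_measurable borel"
  shows "(\<integral>y. f y \<partial>empirical_measure n x) = (\<Sum>i<n. f (x i)) / real n"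
  using assms(1)
  by (simp add: empirical_measure_eq_distr integral_distr integral_pmf_of_set lessThan_empty_iff)

lemma empirical_measure_integrable_probs:
  assumes n: "0 < n" and m: "\<And>k. \<psi> k \<in> borel_measurable borel"
  shows "empirical_measure n x \<in> integrable_probs \<psi>"
proof -
  have "prob_space (empirical_measure n x)"
    using n by (simp add: empirical_measure_eq_distr measure_pmf.prob_space_distr)
  moreover have "(\<integral>\<^sup>+y. ennreal (\<psi> k y) \<partial>empirical_measure n x) < \<infinity>" for k
    using n m[of k]
    by (simp add: empirical_measure_eq_distr nn_integral_distr nn_integral_pmf_of_set
        lessThan_empty_iff ennreal_divide_eq_top_iff less_top[symmetric])
  ultimately show ?thesis
    using n by (simp add: integrable_probs_def borel_probs_def empirical_measure_eq_distr)
qed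

lemma empirical_measure_const:
  assumes "0 < n" "\<And>i. i < n \<Longrightarrow> x i = y"
  shows "empirical_measure n x = return borel y"
proof (rule measure_eqI)
  fix A assume "A \<in> sets (empirical_measure n x)"
  then have A: "A \<in> sets borel" using assms(1) by (simp add: empirical_measure_eq_distr)
  have "emeasure (empirical_measure n x) A =
    (\<integral>\<^sup>+i. indicator A (x i) \<partial>measure_pmf (pmf_of_set {..<n}))"
    using A assms(1) nn_integral_distr[of x "measure_pmf (pmf_of_set {..<n})" borel "indicator A"]
    by (simp add: empirical_measure_eq_distr)
  also have "\<dots> = (\<integral>\<^sup>+i. indicator A y \<partial>measure_pmf (pmf_of_set {..<n}))"
    using assms by (intro nn_integral_cong_AE) (auto simp: AE_measure_pmf_iff lessThan_empty_iff)
  finally show "emeasure (empirical_measure n x) A = emeasure (return borel y) A"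
    using A by (simp add: measure_pmf.emeasure_space_1)
qed (use assms in \<open>simp add: empirical_measure_eq_distr\<close>)

lemma empirical_measure_neq_return:
  fixes x :: "nat \<Rightarrow> real"
  assumes "j < n" "x j \<noteq> y"
  shows "empirical_measure n x \<noteq> return borel y"
proof
  assume *: "empirical_measure n x = return borel y"
  \<comment> \<open>The bounded test function \<open>min 1 \<bar>z - y\<bar>\<close> vanishes only
    at \<open>y\<close>, so it separates the two measures.\<close>
  have "(\<Sum>i<n. min 1 \<bar>x i - y\<bar>) / real n = (\<integral>z. min 1 \<bar>z - y\<bar> \<partial>empirical_measure n x)"
    using assms by (subst integral_empirical_measure) auto
  also have "\<dots> = 0" unfolding * by (subst integral_return) auto
  finally have "(\<Sum>i<n. min 1 \<bar>x i - y\<bar>) = 0" using assms by simp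
  then have "min 1 \<bar>x j - y\<bar> = 0"
    using assms(1) by (subst (asm) sum_nonneg_eq_0_iff) auto
  then show False using assms(2) by (auto simp: min_def split: if_splits)
qed

lemma log_likelihood_empirical_measure:
  assumes "0 < n" "0 < b"
  shows "log_likelihood (empirical_measure n x) b =
    (\<Sum>i<n. ln b - b * x i - exp (- (b * x i))) / real n"
proof -
  have "ln (gumbel_density b y) = ln b - b * y - exp (- (b * y))" for y
    using assms(2) by (simp add: gumbel_density_def ln_mult)
  then show ?thesis
    unfolding log_likelihood_def using assms by (simp add: integral_empirical_measure)
qed

text \<open>The log-likelihoods at \<open>c\<close> and \<open>b\<close> are compared directly,
  without differentiation: tangent bounds at \<open>b\<close> for \<open>ln\<close> and
  \<open>exp\<close> and mean score 1 leave the negative number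
  \<open>ln c - ln b - (c - b) / b\<close>. The bound for \<open>ln\<close> is strict, which makes
  the maximizer unique.\<close>

lemma gumbel_mle_empirical_measure:
  assumes n: "0 < n" and b: "0 < b" "mean_score n x b = 1"
  shows "gumbel_mle (empirical_measure n x) = b"
proof -
  let ?L = "log_likelihood (empirical_measure n x)"
  have less: "?L c < ?L b" if c: "0 < c" "c \<noteq> b" for c
  proof -
    have ln: "ln c - ln b < (c - b) / b"
      using ln_le_minus_one[of "c / b"] ln_eq_minus_one[of "c / b"] b c
      by (simp add: ln_div field_simps order_less_le) metis
    have "ln c - c * t - exp (- (c * t)) - (ln b - b * t - exp (- (b * t)))
        \<le> ln c - ln b - (c - b) / b * score (b * t)" for t
    proof -
      \<comment> \<open>The tangent of \<open>exp\<close> at \<open>- (b * t)\<close>; its linear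
        term is what combines to the score.\<close>
      have "exp (- (b * t)) * (1 + (b * t - c * t)) \<le> exp (- (b * t)) * exp (b * t - c * t)"
        by (intro mult_left_mono exp_ge_add_one_self) auto
      also have "\<dots> = exp (- (c * t))" by (simp add: exp_add[symmetric])
      finally have "(b - c) * t * exp (- (b * t)) + exp (- (b * t)) \<le> exp (- (c * t))"
        by (simp add: algebra_simps)
      moreover have "(c - b) / b * score (b * t) = (c - b) * t * (1 - exp (- (b * t)))"
        using b by (simp add: score_def)
      ultimately show ?thesis by (simp add: algebra_simps)
    qed
    then have "(\<Sum>i<n. ln c - c * x i - exp (- (c * x i)) - (ln b - b * x i - exp (- (b * x i))))
        \<le> (\<Sum>i<n. ln c - ln b - (c - b) / b * score (b * x i))"
      by (intro sum_mono)
    also have "\<dots> = real n * (ln c - ln b) - (c - b) / b * (\<Sum>i<n. score (b * x i))"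
      by (simp add: sum_subtractf sum_distrib_left)
    also have "(\<Sum>i<n. score (b * x i)) = real n"
      using b n by (simp add: mean_score_def field_simps)
    also have "real n * (ln c - ln b) - (c - b) / b * real n < 0"
      using mult_strict_left_mono[OF ln, of "real n"] n by (simp add: mult.commute)
    finally have "(\<Sum>i<n. ln c - c * x i - exp (- (c * x i)))
        < (\<Sum>i<n. ln b - b * x i - exp (- (b * x i)))"
      by (simp only: sum_subtractf)
    with n b c show ?thesis
      by (simp add: log_likelihood_empirical_measure divide_strict_right_mono)
  qed
  show ?thesis
    unfolding gumbel_mle_def
  proof (rule the_equality)
    show "0 < b \<and> (\<forall>c>0. ?L c \<le> ?L b)"
      using b less by (metis less_eq_real_def)
    show "a = b" if "0 < a \<and> (\<forall>c>0. ?L c \<le> ?L a)" for a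
      using that b less[of a] by force
  qed
qed

section \<open>Gumbel distributions and infinite products\<close>

lemma gumbel_density_nonneg: "0 \<le> a \<Longrightarrow> 0 \<le> gumbel_density a x"
  by (simp add: gumbel_density_def)

lemma borel_measurable_gumbel_density [measurable]: "gumbel_density a \<in> borel_measurable borel"
  unfolding gumbel_density_def by measurable

lemma gumbel_density_1: "gumbel_density 1 x = exp (- x) * exp (- exp (- x))"
  by (simp add: gumbel_density_def exp_add[symmetric])

lemma sets_gumbel [measurable_cong, simp]: "sets (gumbel a) = sets borel"
  by (simp add: gumbel_def)

lemma space_gumbel [simp]: "space (gumbel a) = UNIV"
  by (simp add: gumbel_def)

lemma prob_space_gumbel_1: "prob_space (gumbel 1)"
proof
  \<comment> \<open>The standard Gumbel distribution function, an antiderivative of the density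
    rising from 0 to 1.\<close>
  let ?F = "\<lambda>x::real. exp (- exp (- x))"
  have deriv: "DERIV ?F x :> gumbel_density 1 x" for x
    unfolding gumbel_density_1 by (auto intro!: derivative_eq_intros)
  have bot: "((?F \<circ> real_of_ereal) \<longlongrightarrow> 0) (at_right (-\<infinity>))"
    unfolding ereal_tendsto_simps
    by (intro filterlim_compose[OF exp_at_bot] filterlim_uminus_at_bot_at_top[THEN filterlim_compose]
        filterlim_compose[OF exp_at_top] filterlim_uminus_at_top_at_bot)
  have top: "((?F \<circ> real_of_ereal) \<longlongrightarrow> 1) (at_left \<infinity>)"
    unfolding ereal_tendsto_simps
    by (rule tendsto_eq_intros filterlim_compose[OF exp_at_bot] filterlim_uminus_at_bot_at_top
        | simp)+
  have cont: "isCont (gumbel_density 1) x" for x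
    unfolding gumbel_density_def by (intro continuous_intros)
  have "set_integrable lborel (einterval (-\<infinity>) \<infinity>) (gumbel_density 1)"
    and "(LBINT x=-\<infinity>..\<infinity>. gumbel_density 1 x) = 1 - 0"
    by (rule interval_integral_FTC_nonneg[OF _ _ _ _ bot top];
        simp add: deriv cont gumbel_density_nonneg)+
  then have "integrable lborel (gumbel_density 1)" "(\<integral>x. gumbel_density 1 x \<partial>lborel) = 1"
    by (simp_all add: set_integrable_def interval_lebesgue_integral_def set_lebesgue_integral_def)
  then have "(\<integral>\<^sup>+x. ennreal (gumbel_density 1 x) \<partial>lborel) = 1"
    by (subst nn_integral_eq_integral) (auto simp: gumbel_density_nonneg)
  then show "emeasure (gumbel 1) (space (gumbel 1)) = 1"
    by (simp add: gumbel_def emeasure_density)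
qed

lemma gumbel_eq_distr:
  assumes "0 < a"
  shows "gumbel a = distr (gumbel 1) borel (\<lambda>x. x / a)"
proof (rule measure_eqI)
  fix A assume "A \<in> sets (gumbel a)"
  then have A [measurable]: "A \<in> sets borel" by simp
  have "emeasure (distr (gumbel 1) borel (\<lambda>x. x / a)) A
      = (\<integral>\<^sup>+x. indicator A (x / a) \<partial>gumbel 1)"
    using nn_integral_distr[of "\<lambda>x. x / a" "gumbel 1" borel "indicator A"] by simp
  also have "\<dots> = (\<integral>\<^sup>+x. ennreal (gumbel_density 1 x) * indicator A (x / a) \<partial>lborel)"
    unfolding gumbel_def by (subst nn_integral_density) auto
  \<comment> \<open>Substitution of \<open>a * x\<close> for \<open>x\<close>; then
    \<open>a * gumbel_density 1 (a * x) = gumbel_density a x\<close>.\<close>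
  also have "\<dots> = ennreal a * (\<integral>\<^sup>+x. ennreal (gumbel_density 1 (a * x)) * indicator A x \<partial>lborel)"
    using assms by (subst nn_integral_real_affine[where c = a and t = 0]) auto
  also have "\<dots> = (\<integral>\<^sup>+x. ennreal (gumbel_density a x) * indicator A x \<partial>lborel)"
    using assms
    by (subst nn_integral_cmult[symmetric])
      (auto intro!: nn_integral_cong simp: gumbel_density_def ennreal_mult' mult.assoc)
  also have "\<dots> = emeasure (gumbel a) A"
    unfolding gumbel_def by (subst emeasure_density) auto
  finally show "emeasure (gumbel a) A = emeasure (distr (gumbel 1) borel (\<lambda>x. x / a)) A" ..
qed simp

lemma prob_space_gumbel: "0 < a \<Longrightarrow> prob_space (gumbel a)"
  by (subst gumbel_eq_distr) (auto intro: prob_space.prob_space_distr[OF prob_space_gumbel_1])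

lemma AE_gumbel_neq: "AE x in gumbel a. x \<noteq> c"
  unfolding gumbel_def using AE_lborel_singleton[of c]
  by (subst AE_density) (auto elim: eventually_mono)

section \<open>Integrability of the score under the standard Gumbel law\<close>

lemma power_le_exp:
  fixes x :: real
  assumes "0 \<le> x"
  shows "(1 + x / real (Suc n)) ^ Suc n \<le> exp x"
proof -
  have "(1 + x / real (Suc n)) ^ Suc n \<le> exp (x / real (Suc n)) ^ Suc n"
    using assms by (intro power_mono exp_ge_add_one_self) auto
  also have "\<dots> = exp x"
    by (subst exp_of_nat_mult[symmetric]) simp
  finally show ?thesis .
qed

lemma mult_exp_neg_le:
  fixes x :: real
  assumes "0 \<le> x"
  shows "x * exp (- x) \<le> 27 * inverse (1 + x\<^sup>2)"
proof -
  \<comment> \<open>The factor 27 clears the denominator of \<open>(x / 3) ^ 3\<close>, so that the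
    expansion contains \<open>x ^ 3\<close> and \<open>27 * x\<close> and dominates
    \<open>x + x ^ 3\<close>.\<close>
  have "27 * (1 + x / 3) ^ 3 = 27 + 27 * x + 9 * x\<^sup>2 + x ^ 3"
    by (simp add: power3_eq_cube power2_eq_square field_simps)
  then have "x * (1 + x\<^sup>2) \<le> 27 * (1 + x / 3) ^ 3"
    using assms by (simp add: power3_eq_cube power2_eq_square algebra_simps)
  also have "\<dots> \<le> 27 * exp x"
    using power_le_exp[OF assms, of 2] by (simp add: eval_nat_numeral)
  finally show ?thesis
    by (simp add: exp_minus field_simps add_pos_nonneg)
qed

text \<open>On the right the product is at most \<open>x * exp (- x)\<close>. On the left, with
  \<open>u = - x\<close>, the double exponential beats every power of \<open>exp u\<close>; the
  fourth power leaves at most \<open>256 * (u * exp (- u))\<close>, and 6912 is 256 times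
  27.\<close>

lemma score_gumbel_density_le:
  "score x * gumbel_density 1 x \<le> 6912 * inverse (1 + x\<^sup>2)"
proof (cases "0 \<le> x")
  case True
  have "score x * gumbel_density 1 x \<le> x * exp (- x)"
    using True unfolding score_def gumbel_density_1
    by (intro mult_mono mult_left_le) auto
  also have "\<dots> \<le> 27 * inverse (1 + x\<^sup>2)" using mult_exp_neg_le[OF True] .
  also have "\<dots> \<le> 6912 * inverse (1 + x\<^sup>2)" by simp
  finally show ?thesis .
next
  case False
  define u where "u = - x"
  have u: "0 \<le> u" "x = - u" using False by (auto simp: u_def)
  \<comment> \<open>Here \<open>256 = 4 ^ 4\<close> comes from
    \<open>(1 + y / 4) ^ 4 \<le> exp y\<close> at \<open>y = exp u\<close>.\<close>
  have "exp u ^ 4 = 256 * (exp u / 4) ^ 4"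
    by (simp add: power_divide)
  also have "\<dots> \<le> 256 * (1 + exp u / 4) ^ 4"
    by (intro mult_left_mono power_mono) auto
  also have "\<dots> \<le> 256 * exp (exp u)"
    using power_le_exp[of "exp u" 3] by (simp add: eval_nat_numeral)
  finally have *: "exp (- exp u) \<le> 256 * exp (- u) ^ 4"
    by (simp add: exp_minus field_simps)
  have "score x * gumbel_density 1 x = u * (exp u - 1) * exp u * exp (- exp u)"
    by (simp add: score_def gumbel_density_1 u algebra_simps)
  also have "\<dots> \<le> u * exp u * exp u * (256 * exp (- u) ^ 4)"
    using u * by (intro mult_mono) auto
  also have "\<dots> = 256 * (u * exp (- u)) * exp (- u)"
    by (simp add: exp_minus field_simps eval_nat_numeral)
  also have "\<dots> \<le> 256 * (u * exp (- u))"
    using u by (intro mult_left_le) auto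
  also have "\<dots> \<le> 6912 * inverse (1 + x\<^sup>2)"
    using mult_exp_neg_le[OF u(1)] u(2) by simp
  finally show ?thesis .
qed

lemma integrable_score_gumbel: "integrable (gumbel 1) score"
proof -
  have *: "integrable lborel (\<lambda>x::real. 6912 * inverse (1 + x\<^sup>2))"
    using integrable_inverse_1_plus_square by (simp add: set_integrable_def)
  have "integrable lborel (\<lambda>x. gumbel_density 1 x *\<^sub>R score x)"
  proof (rule Bochner_Integration.integrable_bound[OF *])
    show "AE x in lborel. norm (gumbel_density 1 x *\<^sub>R score x)
        \<le> norm (6912 * inverse (1 + x\<^sup>2))"
      using score_gumbel_density_le
      by (intro AE_I2) (simp add: abs_mult score_nonneg gumbel_density_nonneg mult.commute)
  qed measurable
  then show ?thesis
    unfolding gumbel_def by (subst integrable_density) (auto simp: gumbel_density_nonneg)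
qed

text \<open>Preimages of cylinders under a coordinatewise map are cylinders, and a finite measure on
  the product is determined by its values on these. Used to realize all Gumbel samples as rescalings
  of one standard sample.\<close>

lemma PiM_distr:
  assumes M: "prob_space M" and f [measurable]: "f \<in> measurable M N"
  shows "PiM UNIV (\<lambda>_::'i. distr M N f) =
    distr (PiM UNIV (\<lambda>_. M)) (PiM UNIV (\<lambda>_. N)) (\<lambda>\<omega> i. f (\<omega> i))"
proof (rule measure_eqI_PiM_infinite[symmetric])
  interpret N: prob_space "distr M N f" by (rule prob_space.prob_space_distr[OF M f])
  have meas [measurable]: "(\<lambda>\<omega> i. f (\<omega> i)) \<in> measurable (PiM UNIV (\<lambda>_::'i. M)) (PiM UNIV (\<lambda>_. N))"
    by (rule measurable_PiM_single') (auto simp: space_PiM PiE_iff intro: measurable_space[OF f])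
  have eq: "sets (PiM UNIV (\<lambda>_. distr M N f)) = sets (PiM UNIV (\<lambda>_::'i. N))"
    by (intro sets_PiM_cong) auto
  show "sets (distr (PiM UNIV (\<lambda>_. M)) (PiM UNIV (\<lambda>_. N)) (\<lambda>\<omega> (i::'i). f (\<omega> i)))
      = sets (PiM UNIV (\<lambda>_::'i. distr M N f))"
    by (simp add: eq)
  show "finite_measure (distr (PiM UNIV (\<lambda>_. M)) (PiM UNIV (\<lambda>_. N)) (\<lambda>\<omega> (i::'i). f (\<omega> i)))"
    by (intro prob_space.finite_measure prob_space.prob_space_distr prob_space_PiM M) measurable
  fix A :: "'i \<Rightarrow> 'b set" and J :: "'i set"
  assume J: "finite J" "J \<subseteq> UNIV" "\<And>i. i \<in> J \<Longrightarrow> A i \<in> sets (distr M N f)"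
  let ?E = "prod_emb UNIV (\<lambda>_. distr M N f) J (Pi\<^sub>E J A)"
  have "?E \<in> sets (PiM UNIV (\<lambda>_. distr M N f))"
    using J by (intro sets_PiM_I) auto
  then have "emeasure (distr (PiM UNIV (\<lambda>_. M)) (PiM UNIV (\<lambda>_. N)) (\<lambda>\<omega> i. f (\<omega> i))) ?E =
    emeasure (PiM UNIV (\<lambda>_. M)) ((\<lambda>\<omega> i. f (\<omega> i)) -` ?E \<inter> space (PiM UNIV (\<lambda>_. M)))"
    by (subst emeasure_distr) (auto simp: eq)
  also have "(\<lambda>\<omega> i. f (\<omega> i)) -` ?E \<inter> space (PiM UNIV (\<lambda>_. M)) =
      prod_emb UNIV (\<lambda>_. M) J (\<Pi>\<^sub>E i\<in>J. f -` A i \<inter> space M)"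
    using measurable_space[OF f]
    by (auto simp: prod_emb_def space_PiM PiE_iff)
  also have "emeasure (PiM UNIV (\<lambda>_. M)) \<dots> = (\<Prod>i\<in>J. emeasure M (f -` A i \<inter> space M))"
    using J M by (intro emeasure_PiM_emb) auto
  also have "\<dots> = (\<Prod>i\<in>J. emeasure (distr M N f) (A i))"
    using J by (intro prod.cong) (auto simp: emeasure_distr)
  also have "\<dots> = emeasure (PiM UNIV (\<lambda>_. distr M N f)) ?E"
    using J N.prob_space_axioms by (intro emeasure_PiM_emb[symmetric]) auto
  finally show "emeasure (distr (PiM UNIV (\<lambda>_. M)) (PiM UNIV (\<lambda>_. N)) (\<lambda>\<omega> i. f (\<omega> i))) ?E =
    emeasure (PiM UNIV (\<lambda>_. distr M N f)) ?E" .
qed simp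

text \<open>The expected sample mean is the integral of \<open>\<phi>\<close> for every
  \<open>n\<close>, so Markov's inequality gives a bound free of \<open>n\<close>.\<close>

lemma sample_mean_Markov:
  fixes \<phi> :: "'a \<Rightarrow> real"
  assumes M: "prob_space M" and int: "integrable M \<phi>" and nonneg: "\<And>x. 0 \<le> \<phi> x"
    and n: "0 < n" and t: "0 < t"
  shows "measure (PiM UNIV (\<lambda>_::nat. M))
      {\<omega> \<in> space (PiM UNIV (\<lambda>_::nat. M)). t \<le> (\<Sum>i<n. \<phi> (\<omega> i)) / real n} \<le> (\<integral>x. \<phi> x \<partial>M) / t"
proof -
  let ?P = "PiM UNIV (\<lambda>_::nat. M)"
  have [measurable]: "\<phi> \<in> borel_measurable M" using int by auto
  have comp: "distr ?P M (\<lambda>\<omega>. \<omega> i) = M" for i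
    using M by (intro distr_PiM_component) auto
  have inti: "integrable ?P (\<lambda>\<omega>. \<phi> (\<omega> i))" for i
    using int integrable_distr_eq[of "\<lambda>\<omega>. \<omega> i" ?P M \<phi>] by (simp add: comp)
  have "(\<integral>\<omega>. \<phi> (\<omega> i) \<partial>?P) = (\<integral>x. \<phi> x \<partial>M)" for i
    using integral_distr[of "\<lambda>\<omega>. \<omega> i" ?P M \<phi>] by (simp add: comp)
  then have "(\<integral>\<omega>. (\<Sum>i<n. \<phi> (\<omega> i)) / real n \<partial>?P) = (\<integral>x. \<phi> x \<partial>M)"
    using n inti by (simp add: Bochner_Integration.integral_sum)
  moreover have "integrable ?P (\<lambda>\<omega>. (\<Sum>i<n. \<phi> (\<omega> i)) / real n)"
    using inti by (intro integrable_divide_zero Bochner_Integration.integrable_sum) auto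
  ultimately show ?thesis
    using integral_Markov_inequality_measure[of ?P "\<lambda>\<omega>. (\<Sum>i<n. \<phi> (\<omega> i)) / real n" "{}" t] nonneg t
    by (simp add: sum_nonneg)
qed

section \<open>Weak neighbourhoods within the Gumbel family\<close>

lemma gumbel_test_integral_strict_antimono:
  assumes "0 < a" "a < b"
  shows "(\<integral>x. x\<^sup>2 / (1 + x\<^sup>2) \<partial>gumbel b) < (\<integral>x. x\<^sup>2 / (1 + x\<^sup>2) \<partial>gumbel a)"
proof -
  interpret prob_space "gumbel 1" by (rule prob_space_gumbel_1)
  \<comment> \<open>Scaling moves the parameter from the measure into the integrand, which is
    strictly decreasing in \<open>c > 0\<close> at every \<open>x\<close> other than 0.\<close>
  have eq: "(\<integral>x. x\<^sup>2 / (1 + x\<^sup>2) \<partial>gumbel c) = (\<integral>x. x\<^sup>2 / (c\<^sup>2 + x\<^sup>2) \<partial>gumbel 1)" if "0 < c" for c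
  proof -
    have "(\<integral>x. x\<^sup>2 / (1 + x\<^sup>2) \<partial>gumbel c) = (\<integral>x. (x / c)\<^sup>2 / (1 + (x / c)\<^sup>2) \<partial>gumbel 1)"
      using that by (subst gumbel_eq_distr) (simp_all add: integral_distr)
    also have "(\<lambda>x. (x / c)\<^sup>2 / (1 + (x / c)\<^sup>2)) = (\<lambda>x. x\<^sup>2 / (c\<^sup>2 + x\<^sup>2))"
    proof
      fix x
      have "1 + (x / c)\<^sup>2 = (c\<^sup>2 + x\<^sup>2) / c\<^sup>2"
        using that by (simp add: power_divide add_divide_distrib)
      then show "(x / c)\<^sup>2 / (1 + (x / c)\<^sup>2) = x\<^sup>2 / (c\<^sup>2 + x\<^sup>2)"
        using that by (simp add: power_divide)
    qed
    finally show ?thesis .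
  qed
  have int: "integrable (gumbel 1) (\<lambda>x. x\<^sup>2 / (c\<^sup>2 + x\<^sup>2))" for c
    by (rule integrable_const_bound[of _ 1]) (auto simp: divide_le_eq_1 sum_power2_gt_zero_iff intro!: AE_I2)
  have "x\<^sup>2 / (b\<^sup>2 + x\<^sup>2) < x\<^sup>2 / (a\<^sup>2 + x\<^sup>2)" if "x \<noteq> 0" for x :: real
    using that assms by (intro divide_strict_left_mono) (auto intro!: mult_pos_pos add_pos_pos power_strict_mono)
  then have "(\<integral>x. x\<^sup>2 / (b\<^sup>2 + x\<^sup>2) \<partial>gumbel 1) < (\<integral>x. x\<^sup>2 / (a\<^sup>2 + x\<^sup>2) \<partial>gumbel 1)"
    using AE_gumbel_neq[of 0 1]
    by (intro integral_less_AE_space int) (auto elim: eventually_mono simp: emeasure_space_1[simplified])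
  then show ?thesis using assms by (simp add: eq)
qed

text \<open>One test function suffices: its integral is strictly decreasing in the parameter, so an
  open interval of values pins the parameter between \<open>a - \<eta>\<close> and
  \<open>a + \<eta>\<close>.\<close>

lemma weak_neighborhood_gumbel:
  assumes a: "0 < a" and \<delta>: "0 < \<delta>"
  obtains U where "openin (subtopology weak_topology (gumbel ` {0<..})) U" "gumbel a \<in> U"
    "\<And>\<nu>. \<nu> \<in> U \<Longrightarrow> \<exists>b>0. \<bar>b - a\<bar> < \<delta> \<and> \<nu> = gumbel b"
proof -
  \<comment> \<open>The bound \<open>a / 2\<close> keeps \<open>a - \<eta>\<close> positive, inside
    the range where monotonicity is known.\<close>
  define \<eta> where "\<eta> = min (a / 2) \<delta>"
  have \<eta>: "0 < \<eta>" "\<eta> < a" "\<eta> \<le> \<delta>" using a \<delta> by (auto simp: \<eta>_def)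
  let ?f = "\<lambda>x::real. x\<^sup>2 / (1 + x\<^sup>2)"
  define \<Phi> where "\<Phi> b = (\<integral>x. ?f x \<partial>gumbel b)" for b
  have mono: "\<Phi> c < \<Phi> b" if "0 < b" "b < c" for b c
    unfolding \<Phi>_def using that by (rule gumbel_test_integral_strict_antimono)
  define V where "V = {\<Phi> (a + \<eta>)<..<\<Phi> (a - \<eta>)}"
  define W where "W = {\<mu> \<in> borel_probs. (\<integral>x. ?f x \<partial>\<mu>) \<in> V}"
  have "continuous_on UNIV ?f"
    by (intro continuous_intros) (auto simp: add_nonneg_eq_0_iff)
  moreover have "bounded (range ?f)"
    unfolding bounded_iff by (auto simp: divide_le_eq_1 add_pos_nonneg intro!: exI[of _ 1])
  ultimately have "openin weak_topology W"
    unfolding weak_topology_def W_def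
    by (intro topology_generated_by_Basis CollectI exI[of _ ?f] exI[of _ V]) (auto simp: V_def)
  then have "openin (subtopology weak_topology (gumbel ` {0<..})) (W \<inter> gumbel ` {0<..})"
    by (auto simp: openin_subtopology)
  moreover have "gumbel a \<in> W \<inter> gumbel ` {0<..}"
    using a \<eta> mono[of "a - \<eta>" a] mono[of a "a + \<eta>"]
    by (auto simp: W_def V_def \<Phi>_def borel_probs_def prob_space_gumbel)
  moreover have "\<exists>b>0. \<bar>b - a\<bar> < \<delta> \<and> \<nu> = gumbel b" if "\<nu> \<in> W \<inter> gumbel ` {0<..}" for \<nu>
  proof -
    from that obtain b where b: "0 < b" "\<nu> = gumbel b" "\<Phi> (a + \<eta>) < \<Phi> b" "\<Phi> b < \<Phi> (a - \<eta>)"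
      by (auto simp: W_def V_def \<Phi>_def)
    have "b < a + \<eta>" "a - \<eta> < b"
      using mono[of "a + \<eta>" b] mono[of b "a - \<eta>"] b a \<eta> by (smt (verit))+
    with b \<eta> show ?thesis by (intro exI[of _ b]) auto
  qed
  ultimately show ?thesis by (rule that)
qed

section \<open>Uniform tightness\<close>

text \<open>The sets where the score is below \<open>1 / Suc k\<close> decrease to
  \<open>{0}\<close>, a null set.\<close>

lemma score_gumbel_small_ex:
  assumes "0 < \<epsilon>"
  shows "\<exists>\<delta>>0. \<delta> \<le> 1 \<and> measure (gumbel 1) {x. score x < \<delta>} < \<epsilon>"
proof -
  interpret prob_space "gumbel 1" by (rule prob_space_gumbel_1)
  let ?A = "\<lambda>k::nat. {x. score x < 1 / real (Suc k)}"
  have "range ?A \<subseteq> sets (gumbel 1)" by auto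
  moreover have "decseq ?A"
    unfolding decseq_def by (auto elim!: order_less_le_trans intro!: frac_le)
  ultimately have "(\<lambda>k. measure (gumbel 1) (?A k)) \<longlonglongrightarrow> measure (gumbel 1) (\<Inter>k. ?A k)"
    by (intro Lim_measure_decseq) (auto simp: emeasure_eq_measure)
  moreover have "(\<Inter>k. ?A k) = {0}"
  proof (intro equalityI subsetI)
    fix x assume x: "x \<in> (\<Inter>k. ?A k)"
    have "\<not> 0 < score x"
    proof
      assume "0 < score x"
      then obtain k where "1 / real (Suc k) < score x" using nat_approx_posE by blast
      moreover have "score x < 1 / real (Suc k)" using x by blast
      ultimately show False by simp
    qed
    then show "x \<in> {0}" using score_nonneg[of x] score_eq_0_iff[of x] by auto
  qed (auto simp: score_def)
  moreover have "measure (gumbel 1) {0} = 0"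
    using AE_gumbel_neq[of 0 1] by (subst prob_eq_0) auto
  ultimately have "(\<lambda>k. measure (gumbel 1) (?A k)) \<longlonglongrightarrow> 0" by simp
  then have "\<forall>\<^sub>F k in sequentially. measure (gumbel 1) (?A k) < \<epsilon>"
    using assms by (rule order_tendstoD)
  then obtain k where "measure (gumbel 1) (?A k) < \<epsilon>"
    by (auto simp: eventually_sequentially)
  then show ?thesis by (intro exI[of _ "1 / real (Suc k)"]) auto
qed

text \<open>Off the exceptional event the root of the likelihood equation lies between
  \<open>c\<close> and \<open>C\<close>. Scaling to parameter 1 leaves two events: a large sample
  mean of the score, and more than half of the observations having a tiny score. Markov bounds each
  by \<open>\<epsilon> / 2\<close>.\<close>

lemma mean_score_tight:
  assumes "0 < \<epsilon>"
  obtains c C where "0 < c" "c \<le> C"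
    "\<And>n. 0 < n \<Longrightarrow> measure (PiM UNIV (\<lambda>_::nat. gumbel 1))
       {\<omega>. 1 < mean_score n \<omega> c \<or> mean_score n \<omega> C < 1} \<le> \<epsilon>"
proof -
  let ?P = "PiM UNIV (\<lambda>_::nat. gumbel 1)"
  interpret G: prob_space "gumbel 1" by (rule prob_space_gumbel_1)
  interpret P: prob_space ?P by (intro prob_space_PiM prob_space_gumbel_1)
  have space: "space ?P = UNIV" by (simp add: space_PiM)
  define E where "E = (\<integral>x. score x \<partial>gumbel 1)"
  have E: "0 \<le> E" unfolding E_def by (simp add: score_nonneg)
  \<comment> \<open>Chosen so that \<open>c * E \<le> \<epsilon> / 2\<close>; \<open>E + 1\<close>
    avoids a zero denominator, and the cap 1 permits the scaling inequality.\<close>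
  define c where "c = min 1 (\<epsilon> / (2 * (E + 1)))"
  have c: "0 < c" "c \<le> 1" "c \<le> \<epsilon> / (2 * (E + 1))"
    using assms E by (simp_all add: c_def)
  have "c * (2 * (E + 1)) \<le> \<epsilon>"
    using c(3) E by (subst (asm) pos_le_divide_eq) auto
  then have cE: "c * E \<le> \<epsilon> / 2" using c(1) by (simp add: algebra_simps)
  obtain \<delta> where \<delta>: "0 < \<delta>" "\<delta> \<le> 1" "measure (gumbel 1) {x. score x < \<delta>} < \<epsilon> / 4"
    using score_gumbel_small_ex[of "\<epsilon> / 4"] assms by auto
  \<comment> \<open>A mean score below 1 at \<open>C\<close> then forces one below
    \<open>\<delta> / 2\<close> at 1; \<open>\<delta> \<le> 1\<close> ensures
    \<open>1 \<le> C\<close>.\<close>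
  define C where "C = 2 / \<delta>"
  have C: "1 \<le> C" "\<delta> * C = 2" using \<delta> by (auto simp: C_def)
  let ?ind = "indicator {x. score x < \<delta>} :: real \<Rightarrow> real"
  have "measure ?P {\<omega>. 1 < mean_score n \<omega> c \<or> mean_score n \<omega> C < 1} \<le> \<epsilon>" if n: "0 < n" for n
  proof -
    let ?A = "{\<omega> \<in> space ?P. 1 / c \<le> (\<Sum>i<n. score (\<omega> i)) / real n}"
    let ?B = "{\<omega> \<in> space ?P. 1 / 2 \<le> (\<Sum>i<n. ?ind (\<omega> i)) / real n}"
    have "\<omega> \<in> ?A" if "1 < mean_score n \<omega> c" for \<omega>
    proof -
      have "1 < c * mean_score n \<omega> 1"
        using mean_score_scale_le[of c 1 n \<omega>] c that by simp
      then show ?thesis using c space by (simp add: mean_score_def field_simps)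
    qed
    moreover have "\<omega> \<in> ?B" if "mean_score n \<omega> C < 1" for \<omega>
    proof -
      have "mean_score n \<omega> 1 \<le> 1 / C * mean_score n \<omega> C"
        using mean_score_scale_le[of 1 C n \<omega>] C by simp
      also have "\<dots> < 1 / C" using that C(1) by (simp add: field_simps)
      finally have less: "(\<Sum>i<n. score (\<omega> i)) < \<delta> * (real n / 2)"
        using n by (simp add: mean_score_def C_def field_simps)
      \<comment> \<open>Each observation outside the small-score set contributes at least
        \<open>\<delta>\<close>, so fewer than half can lie outside.\<close>
      have "\<delta> * (real n - (\<Sum>i<n. ?ind (\<omega> i))) = (\<Sum>i<n. \<delta> * (1 - ?ind (\<omega> i)))"
        by (simp add: sum_distrib_left[symmetric] sum_subtractf)
      also have "\<dots> \<le> (\<Sum>i<n. score (\<omega> i))"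
        using score_nonneg by (intro sum_mono) (auto simp: indicator_def)
      also note less
      finally have "\<delta> * (real n - (\<Sum>i<n. ?ind (\<omega> i))) < \<delta> * (real n / 2)" .
      then have "real n - (\<Sum>i<n. ?ind (\<omega> i)) < real n / 2"
        using \<delta>(1) by (simp only: mult_less_cancel_left_pos)
      then show ?thesis using n space by (simp add: field_simps)
    qed
    ultimately have "measure ?P {\<omega>. 1 < mean_score n \<omega> c \<or> mean_score n \<omega> C < 1}
        \<le> measure ?P (?A \<union> ?B)"
      by (intro P.finite_measure_mono) auto
    also have "\<dots> \<le> measure ?P ?A + measure ?P ?B"
      by (intro measure_Un_le) measurable
    also have "measure ?P ?A \<le> E / (1 / c)"
      unfolding E_def using c(1) n
      by (intro sample_mean_Markov prob_space_gumbel_1 integrable_score_gumbel score_nonneg) auto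
    also have "E / (1 / c) \<le> \<epsilon> / 2" using cE by (simp add: mult.commute)
    also have "measure ?P ?B \<le> (\<integral>x. ?ind x \<partial>gumbel 1) / (1 / 2)"
      using n
      by (intro sample_mean_Markov prob_space_gumbel_1) (auto simp: G.emeasure_eq_measure)
    also have "(\<integral>x. ?ind x \<partial>gumbel 1) / (1 / 2) \<le> \<epsilon> / 2"
      using \<delta>(3) by simp
    finally show ?thesis by simp
  qed
  moreover have "c \<le> C" using c C by simp
  ultimately show ?thesis using that c(1) by blast
qed

section \<open>The Prohorov distance of coupled laws\<close>

lemma openin_mball_of: "openin (mtopology_of m) (mball_of m x r)"
  by (simp add: Metric_space.openin_mball[OF Metric_space_mspace_mdist] mball_of_def mtopology_of_def)

text \<open>A coupling argument: off \<open>B\<close>, if \<open>X\<close> falls in a set, then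
  \<open>Y\<close> falls in its \<open>\<epsilon>\<close>-enlargement, and \<open>B\<close> costs at
  most \<open>\<epsilon>\<close>.\<close>

lemma prohorov_dist_distr_le:
  assumes M: "prob_space M" and top: "mtopology_of m = top_of_set (mspace m)"
    and X: "X \<in> measurable M (restrict_space borel (mspace m))"
    and Y: "Y \<in> measurable M (restrict_space borel (mspace m))"
    and B: "B \<in> sets M" "measure M B \<le> \<epsilon>" and \<epsilon>: "0 < \<epsilon>"
    and close: "\<And>\<omega>. \<omega> \<in> space M - B \<Longrightarrow> mdist m (X \<omega>) (Y \<omega>) < \<epsilon>"
  shows "prohorov_dist m (distr M (restrict_space borel (mspace m)) X)
    (distr M (restrict_space borel (mspace m)) Y) \<le> \<epsilon>"
proof -
  interpret prob_space M by fact
  let ?N = "restrict_space borel (mspace m)"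
  \<comment> \<open>Stated for fresh \<open>X\<close> and \<open>Y\<close>, so that exchanging them
    gives the second inequality.\<close>
  have *: "measure (distr M ?N X) A
      \<le> measure (distr M ?N Y) {y \<in> mspace m. \<exists>x\<in>A. mdist m x y < \<epsilon>} + \<epsilon>"
    if A: "A \<in> sets ?N" and X: "X \<in> measurable M ?N" and Y: "Y \<in> measurable M ?N"
      and close: "\<And>\<omega>. \<omega> \<in> space M - B \<Longrightarrow> mdist m (X \<omega>) (Y \<omega>) < \<epsilon>" for A X Y
  proof -
    define A' where "A' = {y \<in> mspace m. \<exists>x\<in>A. mdist m x y < \<epsilon>}"
    have "A \<subseteq> mspace m" using sets.sets_into_space[OF A] by (auto simp: space_restrict_space)
    \<comment> \<open>As a union of metric balls the enlargement is open, hence measurable even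
      though \<open>A\<close> is merely Borel.\<close>
    then have "A' = (\<Union>x\<in>A. mball_of m x \<epsilon>)"
      by (fastforce simp: A'_def)
    then have "openin (mtopology_of m) A'"
      by (auto intro!: openin_Union openin_mball_of)
    then have A': "A' \<in> sets ?N"
      unfolding top by (auto simp: openin_open sets_restrict_space)
    have "X -` A \<inter> space M \<subseteq> (Y -` A' \<inter> space M) \<union> B"
      using close measurable_space[OF Y] by (auto simp: A'_def space_restrict_space)
    then have "measure M (X -` A \<inter> space M) \<le> measure M ((Y -` A' \<inter> space M) \<union> B)"
      using B(1) A' Y by (intro finite_measure_mono sets.Un measurable_sets) auto
    also have "\<dots> \<le> measure M (Y -` A' \<inter> space M) + measure M B"
      using B(1) A' Y by (intro measure_Un_le measurable_sets) auto
    finally show ?thesis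
      unfolding A'_def[symmetric] measure_distr[OF X A] measure_distr[OF Y A'] using B(2) by linarith
  qed
  show ?thesis
    unfolding prohorov_dist_def
  proof (rule cInf_lower)
    show "\<epsilon> \<in> {e. 0 < e \<and> (\<forall>A\<in>sets ?N.
        measure (distr M ?N X) A \<le> measure (distr M ?N Y) {y \<in> mspace m. \<exists>x\<in>A. mdist m x y < e} + e \<and>
        measure (distr M ?N Y) A \<le> measure (distr M ?N X) {y \<in> mspace m. \<exists>x\<in>A. mdist m x y < e} + e)}"
      using close by (intro CollectI conjI ballI \<epsilon> *[OF _ X Y] *[OF _ Y X]) (simp_all add: mdist_commute)
  qed (rule bdd_belowI[of _ 0], elim CollectE conjE, rule less_imp_le)
qed

text \<open>A Lebesgue number argument for the cover by balls of radius
  \<open>\<epsilon> / 2\<close>. Only \<open>x\<close> is confined to \<open>K\<close>, because a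
  perturbed estimate may leave the compact interval.\<close>

lemma compact_mdist_uniform:
  fixes m :: "'a::metric_space metric"
  assumes K: "compact K" "K \<subseteq> mspace m" and op: "open (mspace m)"
    and top: "mtopology_of m = top_of_set (mspace m)" and \<epsilon>: "0 < \<epsilon>"
  obtains \<delta> where "0 < \<delta>" "\<And>x y. x \<in> K \<Longrightarrow> dist x y < \<delta> \<Longrightarrow> mdist m x y < \<epsilon>"
proof -
  let ?G = "(\<lambda>z. mball_of m z (\<epsilon> / 2)) ` mspace m"
  have "K \<subseteq> \<Union>?G"
  proof
    fix x assume "x \<in> K"
    then have "x \<in> mspace m" using K(2) by auto
    moreover from this have "mdist m x x = 0" by (subst mdist_zero) auto
    then have "mdist m x x < \<epsilon> / 2" using \<epsilon> by linarith
    ultimately have "x \<in> mspace m" "x \<in> mball_of m x (\<epsilon> / 2)" by auto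
    then show "x \<in> \<Union>?G" by blast
  qed
  moreover have "open G" if "G \<in> ?G" for G
  proof -
    from that obtain z where "G = mball_of m z (\<epsilon> / 2)" by auto
    then have "openin (mtopology_of m) G" by (simp add: openin_mball_of)
    then show ?thesis unfolding top using op by (simp add: openin_open_eq)
  qed
  ultimately obtain \<delta> where \<delta>: "0 < \<delta>" "\<And>x. x \<in> K \<Longrightarrow> \<exists>G\<in>?G. ball x \<delta> \<subseteq> G"
    using Heine_Borel_lemma[OF K(1), of ?G] by metis
  have "mdist m x y < \<epsilon>" if "x \<in> K" "dist x y < \<delta>" for x y
  proof -
    obtain z where z: "z \<in> mspace m" "ball x \<delta> \<subseteq> mball_of m z (\<epsilon> / 2)"
      using \<delta>(2)[OF \<open>x \<in> K\<close>] by auto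
    have "x \<in> ball x \<delta>" "y \<in> ball x \<delta>" using that \<delta>(1) by auto
    then have "x \<in> mball_of m z (\<epsilon> / 2)" "y \<in> mball_of m z (\<epsilon> / 2)" using z(2) by blast+
    then show ?thesis
      using mdist_triangle[of x m z y] mdist_commute[of m x z] by simp
  qed
  with \<delta>(1) show ?thesis by (rule that)
qed

section \<open>Robustness of the estimators along the Gumbel family\<close>

theorem corollary4p11:
  fixes a :: "nat \<Rightarrow> real"
    and m :: "real metric"
    and T :: "real measure \<Rightarrow> real"
  defines "M \<equiv> integrable_probs (psi a) - {return borel 0}"
  assumes "range a = {0<..} \<inter> \<rat>"
    and "mspace m = {0<..}"
    and "mcomplete_of m"
    and "mtopology_of m = top_of_set {0<..}"
    and "\<forall>\<mu>\<in>M. T \<mu> = gumbel_mle \<mu>"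
    and "0 < T (return borel 0)"
  shows "robust_on m (\<lambda>n x. T (empirical_measure n x)) (gumbel ` {0<..})"
proof -
  let ?S = "\<lambda>n x. T (empirical_measure n x)"
  let ?P = "PiM UNIV (\<lambda>_::nat. gumbel 1)"
  let ?N = "restrict_space borel (mspace m)"
  have psi: "psi a k \<in> borel_measurable borel" for k
    unfolding psi_def by measurable
  have S_eq: "?S n x = b" if "0 < n" "0 < b" "mean_score n x b = 1" for n x b
  proof -
    have "\<exists>j<n. x j \<noteq> 0"
      using that(3) by (rule contrapos_pp) (simp add: mean_score_def score_def)
    then have "empirical_measure n x \<in> M"
      using empirical_measure_neq_return empirical_measure_integrable_probs[OF that(1), of "psi a", OF psi]
      by (auto simp: M_def)
    then show ?thesis
      using assms(6) gumbel_mle_empirical_measure[OF that] by simp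
  qed
  have S_root: "0 < ?S n x \<and> mean_score n x (?S n x) = 1" if "j < n" "x j \<noteq> 0" for n x j
    using mean_score_eq_1_ex[of j n x, OF that] S_eq[of n _ x] that(1) by auto
  \<comment> \<open>The all-zero sample yields the Dirac measure excluded from \<open>M\<close>;
    there the estimator takes a fixed positive default value.\<close>
  have S_zero: "?S n x = T (return borel 0)" if "0 < n" "\<And>i. i < n \<Longrightarrow> x i = 0" for n x
    using that by (simp add: empirical_measure_const)
  have S_pos: "0 < ?S n x" if "0 < n" for n x
    using S_root[of _ n x] S_zero[of n x] that assms(7) by metis
  have S_meas: "?S n \<in> measurable (PiM UNIV (\<lambda>_. borel)) ?N" if n: "0 < n" for n
  proof -
    have "{x \<in> space (PiM UNIV (\<lambda>_. borel)). c < ?S n x} \<in> sets (PiM UNIV (\<lambda>_. borel))" for c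
    proof (cases "0 < c")
      case True
      have "c < ?S n x \<longleftrightarrow> (if \<forall>i<n. x i = 0 then c < T (return borel 0) else mean_score n x c < 1)"
        for x
        using S_zero[of n x] S_root[of _ n x] mean_score_less_1_iff[of "?S n x" n x c] n True
        by auto
      then show ?thesis
        unfolding mean_score_def by simp measurable
    next
      case False
      then have "c < ?S n x" for x using S_pos[OF n, of x] by simp
      then show ?thesis by simp
    qed
    then have "?S n \<in> borel_measurable (PiM UNIV (\<lambda>_. borel))"
      by (subst borel_measurable_iff_greater) auto
    then show ?thesis
      using S_pos[OF n] assms(3) by (intro measurable_restrict_space2) auto
  qed
  have scale_meas: "(\<lambda>\<omega> i. \<omega> i / b) \<in> measurable ?P (PiM UNIV (\<lambda>_. borel))" for b :: real
    by (rule measurable_PiM_single') (auto simp: space_PiM)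
  have law: "estimator_law m (?S n) (gumbel b) = distr ?P ?N (\<lambda>\<omega>. ?S n (\<lambda>i. \<omega> i / b))"
    if "0 < n" "0 < b" for n b
  proof -
    have "PiM UNIV (\<lambda>_::nat. gumbel b) = distr ?P (PiM UNIV (\<lambda>_. borel)) (\<lambda>\<omega> i. \<omega> i / b)"
      unfolding gumbel_eq_distr[OF that(2)] by (rule PiM_distr[OF prob_space_gumbel_1]) simp
    then show ?thesis
      using distr_distr[OF S_meas[OF that(1)] scale_meas] by (simp add: estimator_law_def comp_def)
  qed
  show ?thesis
    unfolding robust_on_def
  proof (intro ballI allI impI)
    fix \<mu> \<epsilon> assume "\<mu> \<in> gumbel ` {0<..}" and \<epsilon>: "0 < (\<epsilon>::real)"
    then obtain a0 where a0: "0 < a0" "\<mu> = gumbel a0" by auto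
    obtain c C where c: "0 < c" "c \<le> C" and tight: "\<And>n. 0 < n \<Longrightarrow>
        measure ?P {\<omega>. 1 < mean_score n \<omega> c \<or> mean_score n \<omega> C < 1} \<le> \<epsilon>"
      by (rule mean_score_tight[OF \<epsilon>]) (rule that)
    have K: "{a0 * c..a0 * C} \<subseteq> mspace m"
      unfolding assms(3) using less_le_trans[OF mult_pos_pos[OF a0(1) c(1)]]
      by (intro subsetI) (simp only: greaterThan_iff atLeastAtMost_iff)
    \<comment> \<open>For \<open>s \<le> C\<close>, parameters closer than
      \<open>\<delta> / C\<close> give estimates \<open>a0 * s\<close> and \<open>b * s\<close>
      closer than \<open>\<delta>\<close>.\<close>
    have \<delta>C: "0 < \<delta> / C" if "0 < \<delta>" for \<delta> using that c by simp
    obtain \<delta> where \<delta>: "0 < \<delta>"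
      "\<And>x y. x \<in> {a0 * c..a0 * C} \<Longrightarrow> dist x y < \<delta> \<Longrightarrow> mdist m x y < \<epsilon>"
      by (rule compact_mdist_uniform[OF compact_Icc K _ _ \<epsilon>]) (simp_all add: assms(3,5))
    obtain U where U: "openin (subtopology weak_topology (gumbel ` {0<..})) U" "gumbel a0 \<in> U"
      "\<And>\<nu>. \<nu> \<in> U \<Longrightarrow> \<exists>b>0. \<bar>b - a0\<bar> < \<delta> / C \<and> \<nu> = gumbel b"
      by (rule weak_neighborhood_gumbel[OF a0(1) \<delta>C[OF \<delta>(1)]]) (rule that)
    have "prohorov_dist m (estimator_law m (?S n) \<mu>) (estimator_law m (?S n) \<nu>) \<le> \<epsilon>"
      if "\<nu> \<in> U" "1 \<le> n" for \<nu> n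
    proof -
      obtain b where b: "0 < b" "\<bar>b - a0\<bar> < \<delta> / C" "\<nu> = gumbel b" using U(3)[OF \<open>\<nu> \<in> U\<close>] by auto
      have n: "0 < n" using \<open>1 \<le> n\<close> by simp
      let ?B = "{\<omega>. 1 < mean_score n \<omega> c \<or> mean_score n \<omega> C < 1}"
      have "?B = {\<omega> \<in> space ?P. 1 < mean_score n \<omega> c \<or> mean_score n \<omega> C < 1}"
        by (simp add: space_PiM)
      also have "\<dots> \<in> sets ?P"
        unfolding mean_score_def by measurable
      finally have B: "?B \<in> sets ?P" .
      have close: "mdist m (?S n (\<lambda>i. \<omega> i / a0)) (?S n (\<lambda>i. \<omega> i / b)) < \<epsilon>"
        if "\<omega> \<notin> ?B" for \<omega>
      proof -
        \<comment> \<open>An all-zero sample has mean score 0 at \<open>C\<close>, so it belongs to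
          the exceptional set.\<close>
        have "\<exists>j<n. \<omega> j \<noteq> 0"
        proof (rule ccontr)
          assume "\<not> ?thesis"
          then have "mean_score n \<omega> C = 0" by (simp add: mean_score_def score_def)
          with that show False by simp
        qed
        then have s: "0 < ?S n \<omega>" "mean_score n \<omega> (?S n \<omega>) = 1" using S_root by auto
        let ?s = "?S n \<omega>"
        \<comment> \<open>Scale equivariance: dividing the sample by \<open>d\<close> moves the root
          from \<open>?s\<close> to \<open>d * ?s\<close>.\<close>
        have scaled: "?S n (\<lambda>i. \<omega> i / d) = d * ?s" if "0 < d" for d
          using s that by (intro S_eq n) (simp_all add: mean_score_def)
        have "?s \<le> C"
          using mean_score_less_1_iff[OF s, of C] that c by auto
        moreover have "c \<le> ?s"
        proof (rule ccontr)
          \<comment> \<open>Only \<open>mean_score n \<omega> c \<le> 1\<close> is known here, so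
            the strict criterion does not apply and the scaling inequality supplies the
            strictness.\<close>
          assume "\<not> c \<le> ?s"
          then have less: "?s < c" by simp
          have "1 \<le> ?s / c * mean_score n \<omega> c"
            using mean_score_scale_le[of ?s c n \<omega>] s less by simp
          also have "\<dots> \<le> ?s / c * 1"
            using that s c by (intro mult_left_mono) auto
          also have "\<dots> < 1" using less c by simp
          finally show False by simp
        qed
        moreover have "dist (a0 * ?s) (b * ?s) < \<delta>"
        proof -
          have "dist (a0 * ?s) (b * ?s) = \<bar>b - a0\<bar> * ?s"
            using s(1) by (simp add: dist_real_def left_diff_distrib[symmetric] abs_mult abs_minus_commute)
          also have "\<dots> \<le> \<bar>b - a0\<bar> * C"
            using \<open>?s \<le> C\<close> by (intro mult_left_mono) auto
          also have "\<dots> < \<delta>" using b(2) c by (simp add: pos_less_divide_eq)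
          finally show ?thesis .
        qed
        ultimately show ?thesis
          using \<delta>(2)[of "a0 * ?s" "b * ?s"] a0(1) b(1) by (simp add: scaled)
      qed
      have "prohorov_dist m (distr ?P ?N (\<lambda>\<omega>. ?S n (\<lambda>i. \<omega> i / a0)))
          (distr ?P ?N (\<lambda>\<omega>. ?S n (\<lambda>i. \<omega> i / b))) \<le> \<epsilon>"
        using assms(3,5) close
        by (intro prohorov_dist_distr_le[where B = ?B] prob_space_PiM prob_space_gumbel_1 B tight n \<epsilon>
            measurable_compose[OF scale_meas S_meas]) auto
      then show ?thesis by (simp add: law n a0 b)
    qed
    then show "\<exists>U. openin (subtopology weak_topology (gumbel ` {0<..})) U \<and> \<mu> \<in> U \<and>
        (\<forall>\<nu>\<in>U. \<forall>n\<ge>1. prohorov_dist m (estimator_law m (?S n) \<mu>) (estimator_law m (?S n) \<nu>) \<le> \<epsilon>)"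
      using U(1,2) a0(2) by blast
  qed
qed

end
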